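(* Let $y$ be a square-integrable function of $\mathbf{X}$ with generalized ADD $y(\mathbf{X})=\sum_{u\subseteq\{1,\dots,N\}}y_{u,G}(\mathbf{X}_u)$. Then two distinct generalized ADD component functions $y_{u,G}$ and $y_{v,G}$, where $\emptyset\neq u\subseteq\{1,\dots,N\}$, $\emptyset\neq v\subseteq\{1,\dots,N\}$, and $v\subset u$ (proper inclusion), are orthogonal, i.e., they satisfy $$\mathbb{E}\left[y_{u,G}(\mathbf{X}_u)\,y_{v,G}(\mathbf{X}_v)\right]=0 .$$
   Context: Let $N\in\mathbb{N}$ and let $\mathbf{X}=(X_1,\dots,X_N)$ be an $\mathbb{R}^N$-valued random vector on a complete probability space, with joint probability density function $f_{\mathbf{X}}:\mathbb{R}^N\to[0,\infty)$, not necessarily of product type. For $u\subseteq\{1,\dots,N\}$, $|u|$ is its cardinality, $-u:=\{1,\dots,N\}\setminus u$, $\mathbf{X}_u=(X_i)_{i\in u}$ and $\mathbf{x}_u=(x_i)_{i\in u}$. For $u\neq\emptyset$ the marginal density of $\mathbf{X}_u$ is $f_u(\mathbf{x}_u):=\int_{\mathbb{R}^{N-|u|}}f_{\mathbf{X}}(\mathbf{x})\,d\mathbf{x}_{-u}$. The support of $f_{\mathbf{X}}$ is assumed grid-closed: for any point $\mathbf{x}\in\mathrm{supp}(f_{\mathbf{X}})$ one can traverse in each coordinate direction and find another point $\mathbf{x}'\in\mathrm{supp}(f_{\mathbf{X}})$. Generalized ADD (ANOVA dimensional decomposition): the decomposition $y(\mathbf{X})=\sum_{u\subseteq\{1,\dots,N\}}y_{u,G}(\mathbf{X}_u)$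 of a square-integrable function $y$ (that is, $\mathbb{E}[y(\mathbf{X})^2]<\infty$), where $y_{\emptyset,G}$ is a constant, each $y_{u,G}$ with $u\ne\emptyset$ is a function of $\mathbf{x}_u$ with $\int_{\mathbb{R}^{|u|}}y_{u,G}^2(\mathbf{x}_u)f_u(\mathbf{x}_u)\,d\mathbf{x}_u<\infty$, and the weak annihilating conditions hold: $$\int_{\mathbb{R}}y_{u,G}(\mathbf{x}_u)f_u(\mathbf{x}_u)\,dx_i=0\quad\text{for every } i\in u\neq\emptyset$$ (for almost every value of the remaining variables $x_j$, $j\in u\setminus\{i\}$). *)

theory Defs
  imports "HOL-Probability.Probability"
begin

text \<open>
  A point of \<open>\<real>\<^sup>u\<close>, for a finite index set \<open>u\<close>, is an extensional function in
  \<open>u \<rightarrow>\<^sub>E UNIV\<close>, the carrier of the finite product measure below.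
  In particular \<open>\<real>\<^sup>u\<close> for \<open>u = {}\<close> has exactly one point, so that a function on it is a
  constant.
\<close>

abbreviation leb :: "nat set \<Rightarrow> (nat \<Rightarrow> real) measure" where
  "leb u \<equiv> Pi\<^sub>M u (\<lambda>_. lborel)"

text \<open>
  The Bochner integral below takes the value 0 at the points where the marginal of the density
  is infinite; these form a Lebesgue null set.
\<close>

definition marginal_density ::
  "nat \<Rightarrow> ((nat \<Rightarrow> real) \<Rightarrow> real) \<Rightarrow> nat set \<Rightarrow> (nat \<Rightarrow> real) \<Rightarrow> real" where
  "marginal_density N f u x =
     (\<integral>z. f (merge u ({1..N} - u) (x, z)) \<partial>leb ({1..N} - u))"

text \<open>
  The closure is taken in the product topology of \<^typ>\<open>nat \<Rightarrow> real\<close>. The extensional functions on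
  \<open>{1..N}\<close> form a closed subset, on which this topology is that of \<open>\<real>\<^sup>N\<close>.
\<close>

definition density_support :: "nat \<Rightarrow> ((nat \<Rightarrow> real) \<Rightarrow> real) \<Rightarrow> (nat \<Rightarrow> real) set" where
  "density_support N f = closure {x \<in> space (leb {1..N}). f x \<noteq> 0}"

definition grid_closed :: "nat \<Rightarrow> (nat \<Rightarrow> real) set \<Rightarrow> bool" where
  "grid_closed N S \<longleftrightarrow> (\<forall>x\<in>S. \<forall>i\<in>{1..N}. \<exists>t. t \<noteq> x i \<and> x(i := t) \<in> S)"

text \<open>
  In the following condition the integrand is Lebesgue integrable in \<open>x\<^sub>i\<close> for almost every value
  of the other variables as soon as \<open>g\<close> is measurable and square integrable with respect to the
  marginal density (Cauchy-Schwarz and Fubini), so the value 0 that the Bochner integral assigns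
  to a non-integrable function plays no role.
\<close>

definition weak_annihilating ::
  "nat \<Rightarrow> ((nat \<Rightarrow> real) \<Rightarrow> real) \<Rightarrow> nat set \<Rightarrow> ((nat \<Rightarrow> real) \<Rightarrow> real) \<Rightarrow> bool" where
  "weak_annihilating N f u g \<longleftrightarrow>
     (\<forall>i\<in>u. AE x in leb (u - {i}).
        (\<integral>t. g (x(i := t)) * marginal_density N f u (x(i := t)) \<partial>lborel) = 0)"

definition generalized_ADD ::
  "'a measure \<Rightarrow> nat \<Rightarrow> ('a \<Rightarrow> nat \<Rightarrow> real) \<Rightarrow> ((nat \<Rightarrow> real) \<Rightarrow> real) \<Rightarrow>
   ((nat \<Rightarrow> real) \<Rightarrow> real) \<Rightarrow> (nat set \<Rightarrow> (nat \<Rightarrow> real) \<Rightarrow> real) \<Rightarrow> bool" where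
  "generalized_ADD M N X f y yG \<longleftrightarrow>
     (AE \<omega> in M. y (X \<omega>) = (\<Sum>u\<in>Pow {1..N}. yG u (restrict (X \<omega>) u))) \<and>
     (\<forall>u. u \<noteq> {} \<and> u \<subseteq> {1..N} \<longrightarrow>
        yG u \<in> borel_measurable (leb u) \<and>
        integrable (leb u) (\<lambda>x. (yG u x)\<^sup>2 * marginal_density N f u x) \<and>
        weak_annihilating N f u (yG u))"

end

theory Submission imports Defs begin

text \<open>
  The density of \<open>X\<^sub>u\<close> is the marginal \<open>f\<^sub>u\<close>, so the expectation is the integral of
  \<open>y\<^sub>u y\<^sub>v f\<^sub>u\<close> over \<open>\<real>\<^sup>u\<close>. Choose \<open>i \<in> u - v\<close> and integrate over \<open>x\<^sub>i\<close> first (Fubini): as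
  \<open>y\<^sub>v\<close> does not depend on \<open>x\<^sub>i\<close>, it factors out of the inner integral, and what remains
  vanishes by the weak annihilating condition for \<open>y\<^sub>u\<close>.
\<close>

text \<open>Tonelli: for measurable \<open>A\<close>, the probability of
  \<open>restrict (X \<omega>) I \<in> A\<close> is an integral over the product indexed by
  \<open>J\<close>, which \<open>merge\<close> splits into the coordinates in \<open>I\<close> and
  those in \<open>J - I\<close>; the inner integral is the claimed density. With values in
  \<open>ennreal\<close> no integrability has to be checked.\<close>

lemma (in product_sigma_finite) distributed_restrict_PiM:
  assumes X: "distributed S (Pi\<^sub>M J M) X g"
    and J: "finite J" "I \<subseteq> J"
  shows "distributed S (Pi\<^sub>M I M) (\<lambda>\<omega>. restrict (X \<omega>) I)
    (\<lambda>x. \<integral>\<^sup>+ z. g (merge I (J - I) (x, z)) \<partial>Pi\<^sub>M (J - I) M)"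
    (is "distributed S ?I ?Y ?m")
proof -
  have J_eq: "I \<union> (J - I) = J" using J by auto
  have fin: "finite I" "finite (J - I)" using J by (auto intro: finite_subset)
  interpret K: finite_product_sigma_finite M "J - I" by standard fact
  have g [measurable]: "g \<in> borel_measurable (Pi\<^sub>M J M)"
    by (rule distributed_borel_measurable[OF X])
  have X_meas [measurable]: "X \<in> measurable S (Pi\<^sub>M J M)"
    by (rule distributed_measurable[OF X])
  have restr [measurable]: "(\<lambda>x. restrict x I) \<in> measurable (Pi\<^sub>M J M) ?I"
    by (rule measurable_restrict_subset) fact
  have Y: "?Y \<in> measurable S ?I" by measurable
  have merge [measurable]: "merge I (J - I) \<in> measurable (?I \<Otimes>\<^sub>M Pi\<^sub>M (J - I) M) (Pi\<^sub>M J M)"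
    using measurable_merge[of I "J - I" M] by (simp only: J_eq)
  have m: "?m \<in> borel_measurable ?I" by measurable
  have "distr S ?I ?Y = density ?I ?m"
  proof (rule measure_eqI)
    fix A assume "A \<in> sets (distr S ?I ?Y)"
    then have A [measurable]: "A \<in> sets ?I" by simp
    have "emeasure (distr S ?I ?Y) A = (\<integral>\<^sup>+ \<omega>. indicator A (?Y \<omega>) \<partial>S)"
      using Y by (simp add: nn_integral_distr flip: nn_integral_indicator)
    also have "\<dots> = (\<integral>\<^sup>+ x. g x * indicator A (restrict x I) \<partial>Pi\<^sub>M J M)"
      by (rule distributed_nn_integral[OF X, symmetric]) measurable
    also have "\<dots> = (\<integral>\<^sup>+ x. g x * indicator A (restrict x I) \<partial>Pi\<^sub>M (I \<union> (J - I)) M)"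
      by (simp only: J_eq)
    also have "\<dots> = (\<integral>\<^sup>+ x. (\<integral>\<^sup>+ z. g (merge I (J - I) (x, z)) *
        indicator A (restrict (merge I (J - I) (x, z)) I) \<partial>Pi\<^sub>M (J - I) M) \<partial>?I)"
      by (rule product_nn_integral_fold) (use fin J_eq in \<open>auto simp del: Un_Diff_cancel\<close>)
    also have "\<dots> = (\<integral>\<^sup>+ x. ?m x * indicator A x \<partial>?I)"
    proof (rule nn_integral_cong)
      fix x assume x: "x \<in> space ?I"
      \<comment> \<open>Points of the product space are extensional on \<open>I\<close>. So the
        indicator does not depend on \<open>z\<close> and leaves the inner integral as a
        factor.\<close>
      then have [simp]: "restrict x I = x"
        by (auto simp: space_PiM intro: extensional_restrict)
      have [measurable]: "(\<lambda>z. g (merge I (J - I) (x, z))) \<in> borel_measurable (Pi\<^sub>M (J - I) M)"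
        using x by measurable
      show "(\<integral>\<^sup>+ z. g (merge I (J - I) (x, z)) *
          indicator A (restrict (merge I (J - I) (x, z)) I) \<partial>Pi\<^sub>M (J - I) M) = ?m x * indicator A x"
        by (simp add: nn_integral_multc)
    qed
    also have "\<dots> = emeasure (density ?I ?m) A"
      using m A by (simp add: emeasure_density)
    finally show "emeasure (distr S ?I ?Y) A = emeasure (density ?I ?m) A" .
  qed simp
  with m Y show ?thesis by (simp add: distributed_def)
qed

text \<open>A density of a probability distribution has total integral 1, and a function with finite
  integral is infinite only on a null set.\<close>

lemma (in prob_space) distributed_AE_finite:
  assumes X: "distributed M S X g"
  shows "AE x in S. g x \<noteq> \<infinity>"
proof (rule nn_integral_PInf_AE)
  show "g \<in> borel_measurable S"
    by (rule distributed_borel_measurable[OF X])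
  show "integral\<^sup>N S g \<noteq> \<infinity>"
    using distributed_nn_integral[OF X, of "\<lambda>_. 1"] by (simp add: emeasure_space_1)
qed

lemma marginal_density_nonneg:
  assumes "\<And>x. x \<in> space (leb {1..N}) \<Longrightarrow> 0 \<le> f x" "u \<subseteq> {1..N}" "x \<in> space (leb u)"
  shows "0 \<le> marginal_density N f u x"
  unfolding marginal_density_def
proof (rule Bochner_Integration.integral_nonneg)
  fix z assume "z \<in> space (leb ({1..N} - u))"
  with assms(2,3) show "0 \<le> f (merge u ({1..N} - u) (x, z))"
    by (intro assms(1)) (auto simp: space_PiM PiE_def merge_def extensional_def)
qed

text \<open>Passes from the extended marginal to the real-valued one. Where the extended integral is
  finite, the slice of \<open>f\<close> is nonnegative and integrable, so the two integrals agree.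
  The Bochner integral falls back to 0 only on the null set where the extended one is infinite, and
  densities equal almost everywhere define the same measure.\<close>

lemma (in prob_space) distributed_marginal_density:
  assumes f: "\<And>x. x \<in> space (leb {1..N}) \<Longrightarrow> 0 \<le> f x"
    and X: "distributed M (leb {1..N}) X (\<lambda>x. ennreal (f x))"
    and u: "u \<subseteq> {1..N}"
  shows "distributed M (leb u) (\<lambda>\<omega>. restrict (X \<omega>) u) (\<lambda>x. ennreal (marginal_density N f u x))"
proof -
  interpret product_sigma_finite "\<lambda>_::nat. lborel :: real measure" by standard
  let ?J = "{1..N} - u"
  let ?m = "\<lambda>x. \<integral>\<^sup>+ z. ennreal (f (merge u ?J (x, z))) \<partial>leb ?J"
  interpret K: finite_product_sigma_finite "\<lambda>_::nat. lborel :: real measure" ?J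
    by standard simp
  have J_eq: "u \<union> ?J = {1..N}" using u by auto
  have m: "distributed M (leb u) (\<lambda>\<omega>. restrict (X \<omega>) u) ?m"
    by (rule distributed_restrict_PiM[OF X]) (use u in auto)
  have f_meas [measurable]: "f \<in> borel_measurable (leb {1..N})"
    by (rule distributed_real_measurable[OF f X])
  have merge [measurable]: "merge u ?J \<in> measurable (leb u \<Otimes>\<^sub>M leb ?J) (leb {1..N})"
    using measurable_merge[of u ?J "\<lambda>_. lborel :: real measure"] by (simp only: J_eq)
  have marg: "marginal_density N f u \<in> borel_measurable (leb u)"
    unfolding marginal_density_def by measurable
  have "AE x in leb u. ?m x = ennreal (marginal_density N f u x)"
    using distributed_AE_finite[OF m]
  proof (rule AE_mp, intro AE_I2 impI)
    fix x assume x: "x \<in> space (leb u)" and fin: "?m x \<noteq> \<infinity>"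
    have f_x: "(\<lambda>z. f (merge u ?J (x, z))) \<in> borel_measurable (leb ?J)"
      using x by measurable
    have nonneg: "0 \<le> f (merge u ?J (x, z))" if "z \<in> space (leb ?J)" for z
      using that x u by (intro f) (auto simp: space_PiM PiE_def merge_def extensional_def)
    have "integrable (leb ?J) (\<lambda>z. f (merge u ?J (x, z)))"
      using f_x fin nonneg by (intro integrableI_nonneg) (auto simp: less_top)
    then show "?m x = ennreal (marginal_density N f u x)"
      unfolding marginal_density_def using nonneg by (intro nn_integral_eq_integral) auto
  qed
  then have "density (leb u) ?m = density (leb u) (\<lambda>x. ennreal (marginal_density N f u x))"
    using marg distributed_borel_measurable[OF m] by (intro density_cong) auto
  with m marg show ?thesis by (simp add: distributed_def)
qed

text \<open>The product is dominated by the sum of the squares: \<open>2 * \<bar>a\<bar> *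
  \<bar>b\<bar> \<le> a\<^sup>2 + b\<^sup>2\<close>, and a nonnegative number is at most its
  double.\<close>

lemma integrable_mult_of_squares:
  fixes g h :: "'a \<Rightarrow> real"
  assumes [measurable]: "g \<in> borel_measurable M" "h \<in> borel_measurable M"
    and sq: "integrable M (\<lambda>x. (g x)\<^sup>2)" "integrable M (\<lambda>x. (h x)\<^sup>2)"
  shows "integrable M (\<lambda>x. g x * h x)"
proof (rule Bochner_Integration.integrable_bound)
  show "integrable M (\<lambda>x. (g x)\<^sup>2 + (h x)\<^sup>2)"
    using sq by simp
  have "\<bar>a * b\<bar> \<le> a\<^sup>2 + b\<^sup>2" for a b :: real
    using sum_squares_bound[of "\<bar>a\<bar>" "\<bar>b\<bar>"] mult_nonneg_nonneg[OF abs_ge_zero abs_ge_zero, of a b]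
    unfolding abs_mult power2_abs mult.assoc by linarith
  then show "AE x in M. norm (g x * h x) \<le> norm ((g x)\<^sup>2 + (h x)\<^sup>2)"
    by simp
qed measurable

theorem proposition4p2:
  fixes M :: "'a measure"
    and N :: nat
    and X :: "'a \<Rightarrow> nat \<Rightarrow> real"
    and f y :: "(nat \<Rightarrow> real) \<Rightarrow> real"
    and yG :: "nat set \<Rightarrow> (nat \<Rightarrow> real) \<Rightarrow> real"
    and u v :: "nat set"
  assumes "prob_space M"
    and "complete_measure M"
    and "\<And>x. x \<in> space (leb {1..N}) \<Longrightarrow> 0 \<le> f x"
    and "distributed M (leb {1..N}) X (\<lambda>x. ennreal (f x))"
    and "grid_closed N (density_support N f)"
    and "y \<in> borel_measurable (leb {1..N})"
    and "integrable M (\<lambda>\<omega>. (y (X \<omega>))\<^sup>2)"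
    and "generalized_ADD M N X f y yG"
    and "u \<noteq> {}" and "u \<subseteq> {1..N}"
    and "v \<noteq> {}" and "v \<subseteq> {1..N}"
    and "v \<subset> u"
  shows "integrable M (\<lambda>\<omega>. yG u (restrict (X \<omega>) u) * yG v (restrict (X \<omega>) v)) \<and>
         prob_space.expectation M
           (\<lambda>\<omega>. yG u (restrict (X \<omega>) u) * yG v (restrict (X \<omega>) v)) = 0"
proof -
  interpret prob_space M by fact
  interpret product_sigma_finite "\<lambda>_::nat. lborel :: real measure" by standard
  have comp: "yG w \<in> borel_measurable (leb w)"
      "integrable (leb w) (\<lambda>x. (yG w x)\<^sup>2 * marginal_density N f w x)"
      "weak_annihilating N f w (yG w)"
    if "w \<noteq> {}" "w \<subseteq> {1..N}" for w
    using assms(8) that by (auto simp: generalized_ADD_def)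
  have dist: "distributed M (leb w) (\<lambda>\<omega>. restrict (X \<omega>) w)
      (\<lambda>x. ennreal (marginal_density N f w x))" if "w \<subseteq> {1..N}" for w
    using assms(3,4) that by (rule distributed_marginal_density)
  have nonneg: "0 \<le> marginal_density N f w x" if "w \<subseteq> {1..N}" "x \<in> space (leb w)" for w x
    using assms(3) that by (rule marginal_density_nonneg)
  \<comment> \<open>The marginal is the density of the restricted vector, so square integrability
    with the marginal as weight becomes square integrability on \<open>M\<close>.\<close>
  have sq: "integrable M (\<lambda>\<omega>. (yG w (restrict (X \<omega>) w))\<^sup>2)" if "w \<noteq> {}" "w \<subseteq> {1..N}" for w
    using distributed_integrable[OF dist[OF that(2)], of "\<lambda>x. (yG w x)\<^sup>2"] comp[OF that] nonneg[OF that(2)]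
    by (simp add: mult.commute)
  have meas: "(\<lambda>\<omega>. yG w (restrict (X \<omega>) w)) \<in> borel_measurable M" if "w \<noteq> {}" "w \<subseteq> {1..N}" for w
    using measurable_compose[OF distributed_measurable[OF dist] comp(1)] that by blast
  let ?m = "marginal_density N f u"
  let ?g = "\<lambda>x. yG u x * yG v (restrict x v)"
  have int: "integrable M (\<lambda>\<omega>. yG u (restrict (X \<omega>) u) * yG v (restrict (X \<omega>) v))"
    using assms(9-12) by (intro integrable_mult_of_squares meas sq)
  \<comment> \<open>Restricting to \<open>u\<close> and then to \<open>v\<close> is restricting to
    \<open>u \<inter> v\<close>. This lets the second factor be read as a function on
    \<open>leb u\<close>.\<close>
  have uv: "u \<inter> v = v" using assms(13) by auto
  have restr: "(\<lambda>x. restrict x v) \<in> measurable (leb u) (leb v)"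
    by (rule measurable_restrict_subset) (use assms(13) in auto)
  have g: "?g \<in> borel_measurable (leb u)"
    using comp(1)[OF assms(9,10)] measurable_compose[OF restr comp(1)[OF assms(11,12)]]
    by (rule borel_measurable_times)
  \<comment> \<open>Integrability on \<open>M\<close> is carried over to \<open>leb u\<close>, where
    Fubini requires it.\<close>
  have int_u: "integrable (leb u) (\<lambda>x. ?m x * ?g x)"
    using distributed_integrable[OF dist[OF assms(10)] g nonneg[OF assms(10)]] int
    by (simp add: uv)
  obtain i where i: "i \<in> u" "i \<notin> v" using assms(13) by blast
  have u_eq: "insert i (u - {i}) = u" using i by auto
  have fin: "finite (u - {i})" using assms(10) by (auto intro: finite_subset)
  have v_upd: "restrict (x(i := t)) v = restrict x v" for x :: "nat \<Rightarrow> real" and t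
    using i by (auto simp: restrict_def fun_eq_iff)
  have "expectation (\<lambda>\<omega>. yG u (restrict (X \<omega>) u) * yG v (restrict (X \<omega>) v)) =
      (\<integral>x. ?m x * ?g x \<partial>leb u)"
    using distributed_integral[OF dist[OF assms(10)] g nonneg[OF assms(10)]]
    by (simp add: uv)
  also have "\<dots> = (\<integral>x. (\<integral>t. ?m (x(i := t)) * ?g (x(i := t)) \<partial>lborel) \<partial>leb (u - {i}))"
    using product_integral_insert[OF fin, of i "\<lambda>x. ?m x * ?g x"] int_u
    unfolding u_eq by simp
  \<comment> \<open>Pulling out a factor constant in \<open>t\<close> is valid for every slice: if
    the slice is not integrable, both sides are 0 by the default value of the Bochner
    integral.\<close>
  also have "\<dots> = (\<integral>x. yG v (restrict x v) *
      (\<integral>t. yG u (x(i := t)) * ?m (x(i := t)) \<partial>lborel) \<partial>leb (u - {i}))"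
    by (simp add: v_upd mult_ac flip: integral_mult_right_zero)
  also have "\<dots> = 0"
  proof (rule integral_eq_zero_AE)
    \<comment> \<open>The annihilating condition is known only for almost every value of the
      remaining variables, which suffices for the outer integral to vanish.\<close>
    have "AE x in leb (u - {i}). (\<integral>t. yG u (x(i := t)) * ?m (x(i := t)) \<partial>lborel) = 0"
      using comp(3)[OF assms(9,10)] i by (auto simp: weak_annihilating_def)
    then show "AE x in leb (u - {i}). yG v (restrict x v) *
        (\<integral>t. yG u (x(i := t)) * ?m (x(i := t)) \<partial>lborel) = 0"
      by eventually_elim simp
  qed
  finally show ?thesis using int by simp
qed

end
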